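(* Let $G$ be an $n$-vertex connected graph with minimum degree $\delta$ and let $G^c$ be the complement of $G$. If $q_1(G^c)<2\delta$, then $G$ has a fractional perfect matching.
   Context: Graphs are simple and undirected. For a graph $G$, $A(G)$ is its adjacency matrix, $D(G)$ the diagonal matrix of vertex degrees, $Q(G)=D(G)+A(G)$ its signless Laplacian, and $q_1(G)$ the largest eigenvalue of $Q(G)$. The complement $G^c$ has vertex set $V(G)$ and its edges are the pairs of distinct nonadjacent vertices of $G$. A fractional matching of $G$ is a function $f:E(G)\to[0,1]$ such that $\sum_{e\in\Gamma(v)}f(e)\le 1$ for each $v\in V(G)$, where $\Gamma(v)$ is the set of edges incident to $v$. A fractional perfect matching of an $n$-vertex graph $G$ is a fractional matching $f$ with $\sum_{e\in E(G)}f(e)=\frac{n}{2}$. *)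

theory Defs
  imports
    Complex_Main
    "Graph_Theory.Digraph_Component"
    "Jordan_Normal_Form.Char_Poly"
begin

(* Graphs are values of type 'a pair_pre_digraph satisfying pair_graph: a finite vertex set with an
   irreflexive symmetric adjacency relation. Each undirected edge appears as two arcs there, so
   edges, over which fractional matchings sum, are taken to be two-element vertex sets. *)

definition edges :: "'a pair_pre_digraph \<Rightarrow> 'a set set" where
  "edges G = {{u, v} | u v. (u, v) \<in> parcs G}"

definition incident_edges :: "'a pair_pre_digraph \<Rightarrow> 'a \<Rightarrow> 'a set set" where
  "incident_edges G v = {e \<in> edges G. v \<in> e}"

definition vertex_degree :: "'a pair_pre_digraph \<Rightarrow> 'a \<Rightarrow> nat" where
  "vertex_degree G v = card (incident_edges G v)"

definition min_degree :: "'a pair_pre_digraph \<Rightarrow> nat" where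
  "min_degree G = Min (vertex_degree G ` pverts G)"

definition graph_complement :: "'a pair_pre_digraph \<Rightarrow> 'a pair_pre_digraph" where
  "graph_complement G =
    \<lparr>pverts = pverts G,
     parcs = {(u, v). u \<in> pverts G \<and> v \<in> pverts G \<and> u \<noteq> v \<and> (u, v) \<notin> parcs G}\<rparr>"

lemma pair_graph_graph_complement:
  assumes "pair_graph G"
  shows "pair_graph (graph_complement G)"
proof -
  interpret pair_graph G by fact
  have "parcs (graph_complement G) \<subseteq> pverts G \<times> pverts G"
    by (auto simp: graph_complement_def)
  then have "finite (parcs (graph_complement G))"
    by (rule finite_subset) (simp add: pair_finite_verts)
  moreover have "sym (parcs G)"
    using pair_sym_arcs by (simp add: symmetric_def)
  ultimately show ?thesis
    by unfold_locales
      (auto simp: graph_complement_def pair_finite_verts symmetric_def sym_def)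
qed

(* The matrices are taken with respect to an arbitrary but fixed ordering of the vertices;
   another ordering conjugates them by a permutation matrix and has the same eigenvalues. *)

definition vertex_list :: "'a pair_pre_digraph \<Rightarrow> 'a list" where
  "vertex_list G = (SOME vs. distinct vs \<and> set vs = pverts G)"

lemma vertex_list:
  assumes "finite (pverts G)"
  shows "distinct (vertex_list G)" and "set (vertex_list G) = pverts G"
    and "length (vertex_list G) = card (pverts G)"
proof -
  have "\<exists>vs. distinct vs \<and> set vs = pverts G"
    using finite_distinct_list[OF assms] by auto
  from someI_ex[OF this]
  show "distinct (vertex_list G)" and "set (vertex_list G) = pverts G"
    by (simp_all add: vertex_list_def)
  then show "length (vertex_list G) = card (pverts G)"
    by (metis distinct_card)
qed

definition adjacency_matrix :: "'a pair_pre_digraph \<Rightarrow> real mat" where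
  "adjacency_matrix G =
    mat (card (pverts G)) (card (pverts G))
      (\<lambda>(i, j). if (vertex_list G ! i, vertex_list G ! j) \<in> parcs G then 1 else 0)"

definition degree_matrix :: "'a pair_pre_digraph \<Rightarrow> real mat" where
  "degree_matrix G =
    mat (card (pverts G)) (card (pverts G))
      (\<lambda>(i, j). if i = j then real (vertex_degree G (vertex_list G ! i)) else 0)"

definition signless_Laplacian :: "'a pair_pre_digraph \<Rightarrow> real mat" where
  "signless_Laplacian G = degree_matrix G + adjacency_matrix G"

(* The matrix is real symmetric, so all its eigenvalues are real and, for a nonempty graph, the
   set below is finite and nonempty. *)

definition q1 :: "'a pair_pre_digraph \<Rightarrow> real" where
  "q1 G = Max {k. eigenvalue (signless_Laplacian G) k}"

definition fractional_matching :: "'a pair_pre_digraph \<Rightarrow> ('a set \<Rightarrow> real) \<Rightarrow> bool" where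
  "fractional_matching G f \<longleftrightarrow>
    (\<forall>e \<in> edges G. 0 \<le> f e \<and> f e \<le> 1) \<and>
    (\<forall>v \<in> pverts G. (\<Sum>e \<in> incident_edges G v. f e) \<le> 1)"

definition fractional_perfect_matching :: "'a pair_pre_digraph \<Rightarrow> ('a set \<Rightarrow> real) \<Rightarrow> bool" where
  "fractional_perfect_matching G f \<longleftrightarrow>
    fractional_matching G f \<and> (\<Sum>e \<in> edges G. f e) = real (card (pverts G)) / 2"

end

theory Submission
  imports Defs "Jordan_Normal_Form.Spectral_Radius"
begin

text \<open>An injection \<open>p\<close> on the vertices with every \<open>v\<close> adjacent to \<open>p v\<close> gives a fractional
  perfect matching: put weight \<open>1/2\<close> on each edge \<open>{v, p v}\<close>. If there is no such \<open>p\<close>, Hall's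
  condition fails for some vertex set \<open>X\<close>, and \<open>T = X - N(X)\<close> is an independent set with
  \<open>|T| > |N(T)| \<ge> \<delta>\<close>. Then \<open>T\<close> is a clique of the complement, whose signless Laplacian
  has row sums at least \<open>2(|T| - 1) \<ge> 2\<delta>\<close> on \<open>T\<close>, which forces \<open>q\<^sub>1 \<ge> 2\<delta>\<close>.\<close>

section \<open>Hall's theorem\<close>

text \<open>Induction on the number of indices. If some nonempty proper \<open>J\<close> is tight,
  \<open>J\<close> and \<open>I - J\<close> are solved separately, the latter avoiding the union of
  the sets of the former. Otherwise every nonempty proper subfamily has a spare element, so one
  index can be served arbitrarily.\<close>

lemma hall_selector:
  fixes A :: "'i \<Rightarrow> 'b set"
  assumes "finite I" and "\<And>i. i \<in> I \<Longrightarrow> finite (A i)"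
    and "\<And>J. J \<subseteq> I \<Longrightarrow> card J \<le> card (\<Union>(A ` J))"
  shows "\<exists>f. inj_on f I \<and> (\<forall>i\<in>I. f i \<in> A i)"
  using assms
proof (induction "card I" arbitrary: I A rule: less_induct)
  case less
  note fin = \<open>finite I\<close> and finA = less.prems(2) and hall = less.prems(3)
  show ?case
  proof (cases "\<exists>J. J \<subset> I \<and> J \<noteq> {} \<and> card (\<Union>(A ` J)) = card J")
    case True
    then obtain J where J: "J \<subset> I" "J \<noteq> {}" and tight: "card (\<Union>(A ` J)) = card J"
      by blast
    define U where "U = \<Union>(A ` J)"
    have finJ: "finite J" using J fin finite_subset by blast
    have finU: "finite U" unfolding U_def using finJ finA J(1) by auto
    have "\<exists>f. inj_on f J \<and> (\<forall>i\<in>J. f i \<in> A i)"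
      by (rule less.hyps) (use J fin finJ finA hall in \<open>auto intro: psubset_card_mono\<close>)
    then obtain f where f: "inj_on f J" "\<And>i. i \<in> J \<Longrightarrow> f i \<in> A i" by blast
    have "\<exists>g. inj_on g (I - J) \<and> (\<forall>i\<in>I - J. g i \<in> A i - U)"
    proof (rule less.hyps)
      show "card (I - J) < card I"
        using J fin by (intro psubset_card_mono) auto
    next
      fix K assume K: "K \<subseteq> I - J"
      have finK: "finite K" using K fin finite_subset by blast
      have finUK: "finite (\<Union>(A ` K))" using finK finA K by auto
      \<comment> \<open>Hall's condition for the reduced sets \<open>A i - U\<close>: apply the
        hypothesis to \<open>J \<union> K\<close> and cancel \<open>card U = card J\<close>.\<close>
      have "card J + card K = card (J \<union> K)"
        by (subst card_Un_disjoint) (use K finJ finK in auto)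
      also have "\<dots> \<le> card (\<Union>(A ` (J \<union> K)))"
        using J K by (intro hall) auto
      also have "\<Union>(A ` (J \<union> K)) = U \<union> (\<Union>i\<in>K. A i - U)"
        unfolding U_def by auto
      also have "card \<dots> = card U + card (\<Union>i\<in>K. A i - U)"
        by (intro card_Un_disjoint finU) (use finUK in \<open>auto intro: finite_subset\<close>)
      finally show "card K \<le> card (\<Union>i\<in>K. A i - U)"
        using tight unfolding U_def by simp
    qed (use fin finA in auto)
    then obtain g where g: "inj_on g (I - J)" "\<And>i. i \<in> I - J \<Longrightarrow> g i \<in> A i - U" by blast
    define h where "h i = (if i \<in> J then f i else g i)" for i
    have fU: "f i \<in> U" if "i \<in> J" for i
      using f(2) that unfolding U_def by blast
    have "inj_on h I"
    proof (rule inj_onI)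
      fix x y assume "x \<in> I" "y \<in> I" "h x = h y"
      then show "x = y"
        using f(1) g(1) fU[of x] fU[of y] g(2)[of x] g(2)[of y]
        by (auto simp: h_def inj_on_def split: if_splits)
    qed
    moreover have "\<forall>i\<in>I. h i \<in> A i"
      using f(2) g(2) by (auto simp: h_def)
    ultimately show ?thesis by blast
  next
    case False
    show ?thesis
    proof (cases "I = {}")
      case True
      then show ?thesis by auto
    next
      case nonempty: False
      then obtain i where i: "i \<in> I" by blast
      have "card {i} \<le> card (\<Union>(A ` {i}))" using i by (intro hall) auto
      then obtain x where x: "x \<in> A i" by fastforce
      have "\<exists>g. inj_on g (I - {i}) \<and> (\<forall>j\<in>I - {i}. g j \<in> A j - {x})"
      proof (rule less.hyps)
        show "card (I - {i}) < card I"
          using i fin by (intro psubset_card_mono) auto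
      next
        fix K assume K: "K \<subseteq> I - {i}"
        show "card K \<le> card (\<Union>j\<in>K. A j - {x})"
        proof (cases "K = {}")
          case False
          \<comment> \<open>\<open>K\<close> misses \<open>i\<close>, hence is a proper subset and
            not tight; its spare element makes up for the loss of \<open>x\<close>.\<close>
          have sub: "K \<subset> I" using K i by blast
          have "card K \<le> card (\<Union>(A ` K))" using sub by (intro hall) auto
          then have "card K < card (\<Union>(A ` K))"
            using \<open>\<not> (\<exists>J. _ J)\<close> False sub by (metis le_neq_implies_less)
          then have "card K \<le> card (\<Union>(A ` K) - {x})"
            unfolding card_Diff_singleton_if by (auto simp del: UN_iff)
          also have "\<Union>(A ` K) - {x} = (\<Union>j\<in>K. A j - {x})" by auto
          finally show ?thesis .
        qed simp
      qed (use fin finA in auto)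
      then obtain g where g: "inj_on g (I - {i})" "\<And>j. j \<in> I - {i} \<Longrightarrow> g j \<in> A j - {x}"
        by blast
      have "inj_on (g(i := x)) I"
      proof (rule inj_onI)
        fix a b assume "a \<in> I" "b \<in> I" "(g(i := x)) a = (g(i := x)) b"
        then show "a = b"
          using g(1) g(2)[of a] g(2)[of b] by (auto simp: inj_on_def split: if_splits)
      qed
      moreover have "\<forall>j\<in>I. (g(i := x)) j \<in> A j"
        using g(2) x by auto
      ultimately show ?thesis by blast
    qed
  qed
qed

section \<open>Fractional perfect matchings\<close>

lemma edges_subset_Pow:
  assumes "pair_graph G"
  shows "edges G \<subseteq> Pow (pverts G)"
proof -
  interpret pair_graph G by fact
  show ?thesis by (auto simp: edges_def dest: in_arcsD1 in_arcsD2)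
qed

lemma finite_edges:
  assumes "pair_graph G"
  shows "finite (edges G)"
proof -
  interpret pair_graph G by fact
  show ?thesis
    using edges_subset_Pow[OF assms] pair_finite_verts finite_subset by blast
qed

text \<open>Each vertex \<open>v\<close> gives weight 1/2 to the edge \<open>{v, p v}\<close>, which
  makes the total half the number of vertices. An edge whose two ends choose each other gets weight
  1. A vertex \<open>u\<close> receives weight only from its own choice and from that of its at most
  one preimage under \<open>p\<close>.\<close>

lemma fractional_perfect_matching_of_selector:
  assumes G: "pair_graph G"
    and inj: "inj_on p (pverts G)"
    and arc: "\<And>v. v \<in> pverts G \<Longrightarrow> (v, p v) \<in> parcs G"
  shows "fractional_perfect_matching G (\<lambda>e. real (card {v \<in> pverts G. {v, p v} = e}) / 2)"
    (is "fractional_perfect_matching G ?f")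
proof -
  interpret pair_graph G by fact
  let ?V = "pverts G"
  have fin: "finite ?V" by (rule pair_finite_verts)
  have edge: "{v, p v} \<in> edges G" if "v \<in> ?V" for v
    using arc[OF that] by (auto simp: edges_def)
  \<comment> \<open>Double counting: the sum over \<open>F\<close> groups the vertices by the edge
    they choose, so each vertex is counted once.\<close>
  have sum_f: "(\<Sum>e\<in>F. ?f e) = real (card {v \<in> ?V. {v, p v} \<in> F}) / 2" if "finite F" for F
  proof -
    let ?S = "{v \<in> ?V. {v, p v} \<in> F}"
    have "(\<Sum>e\<in>F. card {v \<in> ?V. {v, p v} = e}) = (\<Sum>e\<in>F. \<Sum>v\<in>{v. v \<in> ?S \<and> {v, p v} = e}. 1)"
      by (intro sum.cong) (auto intro!: arg_cong[where f = card])
    also have "\<dots> = (\<Sum>v\<in>?S. 1)"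
      by (rule sum.group) (use fin that in auto)
    finally have "(\<Sum>e\<in>F. card {v \<in> ?V. {v, p v} = e}) = card ?S" by simp
    then show ?thesis
      by (simp flip: sum_divide_distrib of_nat_sum)
  qed
  have le1: "?f e \<le> 1" if e: "e \<in> edges G" for e
  proof -
    obtain a b where ab: "e = {a, b}" using e by (auto simp: edges_def)
    have "card {v \<in> ?V. {v, p v} = e} \<le> card {a, b}"
      by (rule card_mono) (auto simp: ab)
    also have "\<dots> \<le> 2" by (simp add: card_insert_if)
    finally show ?thesis by simp
  qed
  have at_vertex: "(\<Sum>e\<in>incident_edges G u. ?f e) \<le> 1" for u
  proof -
    have "{v \<in> ?V. {v, p v} \<in> incident_edges G u} \<subseteq> {u} \<union> {v \<in> ?V. p v = u}"
      by (auto simp: incident_edges_def)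
    then have "card {v \<in> ?V. {v, p v} \<in> incident_edges G u} \<le> card ({u} \<union> {v \<in> ?V. p v = u})"
      using fin by (intro card_mono) auto
    also have "\<dots> \<le> card {u} + card {v \<in> ?V. p v = u}"
      by (rule card_Un_le)
    also have "card {v \<in> ?V. p v = u} \<le> 1"
      using inj by (intro card_le_Suc0_iff_eq[THEN iffD2, simplified One_nat_def[symmetric]])
        (use fin in \<open>auto simp: inj_on_def\<close>)
    finally have "card {v \<in> ?V. {v, p v} \<in> incident_edges G u} \<le> 2" by simp
    moreover have "finite (incident_edges G u)"
      using finite_edges[OF G] by (simp add: incident_edges_def)
    ultimately show ?thesis by (subst sum_f) auto
  qed
  have "{v \<in> ?V. {v, p v} \<in> edges G} = ?V" using edge by auto
  then have "(\<Sum>e\<in>edges G. ?f e) = real (card ?V) / 2"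
    using sum_f[OF finite_edges[OF G]] by simp
  then show ?thesis
    unfolding fractional_perfect_matching_def fractional_matching_def
    using le1 at_vertex by auto
qed

text \<open>A neighbour \<open>u\<close> and the edge \<open>{v, u}\<close> determine each other, so
  counting edges as sets agrees with counting the arcs out of \<open>v\<close>.\<close>

lemma vertex_degree_eq_card_neighbours:
  assumes "pair_graph G"
  shows "vertex_degree G v = card {u. (v, u) \<in> parcs G}"
proof -
  interpret pair_graph G by fact
  have symm: "(b, a) \<in> parcs G" if "(a, b) \<in> parcs G" for a b
    using pair_sym_arcs that by (auto simp: symmetric_def sym_def)
  have "incident_edges G v = (\<lambda>u. {v, u}) ` {u. (v, u) \<in> parcs G}"
    by (auto simp: incident_edges_def edges_def insert_commute dest: symm)
  moreover have "inj_on (\<lambda>u. {v, u}) {u. (v, u) \<in> parcs G}"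
    by (auto simp: inj_on_def doubleton_eq_iff)
  ultimately show ?thesis
    by (simp add: vertex_degree_def card_image)
qed

text \<open>By Hall's theorem a missing selector yields \<open>X\<close> with fewer neighbours than
  elements. Removing \<open>X \<inter> ?N X\<close> from both \<open>X\<close> and
  \<open>?N X\<close> lowers both cardinalities equally, so \<open>T\<close> still outnumbers
  \<open>?N T\<close>; it is independent because none of its elements has a neighbour in
  \<open>X\<close>.\<close>

lemma independent_set_of_no_fractional_perfect_matching:
  assumes G: "pair_graph G"
    and no: "\<nexists>f. fractional_perfect_matching G f"
  obtains T where "T \<subseteq> pverts G" and "\<And>u v. u \<in> T \<Longrightarrow> v \<in> T \<Longrightarrow> (u, v) \<notin> parcs G"
    and "min_degree G < card T"
proof -
  interpret pair_graph G by fact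
  let ?V = "pverts G"
  let ?N = "\<lambda>X. \<Union>v\<in>X. {u. (v, u) \<in> parcs G}"
  have fin: "finite ?V" by (rule pair_finite_verts)
  have symm: "(b, a) \<in> parcs G" if "(a, b) \<in> parcs G" for a b
    using pair_sym_arcs that by (auto simp: symmetric_def sym_def)
  have NV: "?N X \<subseteq> ?V" for X by (auto dest: in_arcsD2)
  have finN: "finite (?N X)" for X using NV fin by (rule finite_subset)
  have "\<not> (\<forall>X\<subseteq>?V. card X \<le> card (?N X))"
  proof
    assume hall: "\<forall>X\<subseteq>?V. card X \<le> card (?N X)"
    have "\<exists>p. inj_on p ?V \<and> (\<forall>v\<in>?V. p v \<in> {u. (v, u) \<in> parcs G})"
      by (rule hall_selector) (use fin finN[of "{_}"] hall in auto)
    then show False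
      using fractional_perfect_matching_of_selector[OF G] no by blast
  qed
  then obtain X where X: "X \<subseteq> ?V" and small: "card (?N X) < card X"
    by (auto simp: not_le)
  define T where "T = X - ?N X"
  have finX: "finite X" using X fin by (rule finite_subset)
  have "card X = card T + card (X \<inter> ?N X)"
    unfolding T_def using card_Int_Diff[OF finX, of "?N X"] by simp
  moreover have "card (?N X) = card (?N X - X) + card (X \<inter> ?N X)"
    using card_Int_Diff[OF finN[of X], of X] by (simp add: Int_commute)
  \<comment> \<open>A neighbour of \<open>T\<close> lying in \<open>X\<close> would by symmetry put
    an element of \<open>T\<close> into \<open>?N X\<close>.\<close>
  moreover have "card (?N T) \<le> card (?N X - X)"
    by (intro card_mono finite_Diff finN) (auto simp: T_def dest: symm)
  ultimately have less: "card (?N T) < card T" using small by linarith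
  then obtain v where v: "v \<in> T" by fastforce
  have TV: "T \<subseteq> ?V" using X by (auto simp: T_def)
  have "min_degree G \<le> vertex_degree G v"
    unfolding min_degree_def using fin v TV by (intro Min_le) auto
  also have "\<dots> \<le> card (?N T)"
    unfolding vertex_degree_eq_card_neighbours[OF G] using v finN by (intro card_mono) auto
  also note less
  finally have "min_degree G < card T" .
  moreover have "(a, b) \<notin> parcs G" if "a \<in> T" "b \<in> T" for a b
    using that by (auto simp: T_def)
  ultimately show thesis using that TV by blast
qed

section \<open>Eigenvalues of symmetric nonnegative matrices\<close>

text \<open>The spectral radius concerns complex eigenvalues; this brings them back to real ones.
  For an eigenvector \<open>v\<close>, the Hermitian form \<open>S\<close> equals \<open>z\<close>
  times the squared norm \<open>N\<close> and is its own conjugate, so \<open>z\<close> is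
  real.\<close>

lemma eigenvalue_of_real_symmetric:
  fixes M :: "real mat"
  assumes M: "M \<in> carrier_mat n n"
    and symm: "\<And>i j. i < n \<Longrightarrow> j < n \<Longrightarrow> M $$ (i, j) = M $$ (j, i)"
    and ev: "eigenvalue (map_mat complex_of_real M) z"
  obtains k where "z = complex_of_real k" and "eigenvalue M k"
proof -
  let ?C = "map_mat complex_of_real M"
  have C: "?C \<in> carrier_mat n n" using M by simp
  obtain v where v: "v \<in> carrier_vec n" "v \<noteq> 0\<^sub>v n" "?C *\<^sub>v v = z \<cdot>\<^sub>v v"
    using ev M unfolding eigenvalue_def eigenvector_def by auto
  define S where "S = (\<Sum>i<n. \<Sum>j<n. complex_of_real (M $$ (i, j)) * v $ j * cnj (v $ i))"
  define N where "N = (\<Sum>i<n. v $ i * cnj (v $ i))"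
  have row: "(\<Sum>j<n. complex_of_real (M $$ (i, j)) * v $ j) = z * v $ i" if "i < n" for i
  proof -
    have "(?C *\<^sub>v v) $ i = (\<Sum>j<n. complex_of_real (M $$ (i, j)) * v $ j)"
      using that M v(1) by (auto simp: scalar_prod_def lessThan_atLeast0 intro!: sum.cong)
    then show ?thesis using v that by simp
  qed
  have "S = (\<Sum>i<n. (\<Sum>j<n. complex_of_real (M $$ (i, j)) * v $ j) * cnj (v $ i))"
    unfolding S_def by (simp add: sum_distrib_right)
  also have "\<dots> = z * N"
    unfolding N_def sum_distrib_left by (intro sum.cong) (auto simp: row)
  finally have SN: "S = z * N" .
  have "cnj S = (\<Sum>i<n. \<Sum>j<n. complex_of_real (M $$ (j, i)) * v $ i * cnj (v $ j))"
    unfolding S_def by (auto simp: symm intro!: sum.cong)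
  also have "\<dots> = S" unfolding S_def by (rule sum.swap)
  finally have cS: "cnj S = S" .
  have N_real: "N = complex_of_real (\<Sum>i<n. (cmod (v $ i))\<^sup>2)"
    unfolding N_def of_real_sum by (simp only: complex_norm_square)
  obtain i where "i < n" "v $ i \<noteq> 0"
    using v(1,2) by (metis eq_vecI carrier_vecD index_zero_vec)
  then have "(\<Sum>i<n. (cmod (v $ i))\<^sup>2) > 0"
    by (intro sum_pos2[of _ i]) auto
  then have "N \<noteq> 0" unfolding N_real by (metis less_irrefl of_real_eq_0_iff)
  moreover have "cnj z * N = z * N" using cS SN unfolding N_real by simp
  ultimately have "cnj z = z" by simp
  then have z: "z = complex_of_real (Re z)"
    by (simp add: complex_eq_iff)
  \<comment> \<open>The vector \<open>v\<close> may have nonreal entries, so it does not directly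
    show that \<open>Re z\<close> is an eigenvalue of \<open>M\<close>. The characteristic
    polynomial does: it has real coefficients and the same root.\<close>
  have "poly (char_poly ?C) z = 0"
    using ev eigenvalue_root_char_poly[OF C] by simp
  then have "poly (map_poly complex_of_real (char_poly M)) (complex_of_real (Re z)) = 0"
    using z of_real_hom.char_poly_hom[OF M] by metis
  then have "poly (char_poly M) (Re z) = 0"
    by simp
  then have "eigenvalue M (Re z)"
    using eigenvalue_root_char_poly[OF M] by simp
  with z show thesis using that by blast
qed

text \<open>Induction on \<open>k\<close>: the last factor contributes at least \<open>c\<close> at
  each index of \<open>I\<close>, and intermediate indices outside \<open>I\<close> only add
  nonnegative terms. Nonnegativity of the powers is carried along because dropping those terms needs
  it.\<close>

lemma pow_mat_row_sums_ge:
  fixes R :: "real mat"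
  assumes R: "R \<in> carrier_mat n n"
    and nonneg: "\<And>i j. i < n \<Longrightarrow> j < n \<Longrightarrow> 0 \<le> R $$ (i, j)"
    and I: "I \<subseteq> {..<n}"
    and rows: "\<And>i. i \<in> I \<Longrightarrow> c \<le> (\<Sum>j\<in>I. R $$ (i, j))" and "0 \<le> c"
  shows "(\<forall>i<n. \<forall>j<n. 0 \<le> (R ^\<^sub>m k) $$ (i, j)) \<and> (\<forall>i\<in>I. c ^ k \<le> (\<Sum>j\<in>I. (R ^\<^sub>m k) $$ (i, j)))"
proof (induction k)
  case 0
  have "(\<Sum>j\<in>I. (1\<^sub>m n :: real mat) $$ (i, j)) = 1" if "i \<in> I" for i
  proof -
    have "(\<Sum>j\<in>I. (1\<^sub>m n :: real mat) $$ (i, j)) = (\<Sum>j\<in>I. if i = j then 1 else 0)"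
      using I that by (intro sum.cong refl index_one_mat(1)) auto
    then show ?thesis using that I finite_subset[OF I] by simp
  qed
  then show ?case using R by auto
next
  case (Suc k)
  have Rk: "R ^\<^sub>m k \<in> carrier_mat n n" using R by simp
  have less: "i < n" if "i \<in> I" for i using I that by auto
  have Rk_nonneg: "0 \<le> (R ^\<^sub>m k) $$ (i, j)" if "i < n" "j < n" for i j
    using Suc that by blast
  have entry: "(R ^\<^sub>m Suc k) $$ (i, j) = (\<Sum>l<n. (R ^\<^sub>m k) $$ (i, l) * R $$ (l, j))"
    if "i < n" "j < n" for i j
    using that R Rk by (auto simp: scalar_prod_def lessThan_atLeast0 intro!: sum.cong)
  have "c ^ Suc k \<le> (\<Sum>j\<in>I. (R ^\<^sub>m Suc k) $$ (i, j))" if i: "i \<in> I" for i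
  proof -
    have "c ^ Suc k \<le> c * (\<Sum>l\<in>I. (R ^\<^sub>m k) $$ (i, l))"
      using Suc i \<open>0 \<le> c\<close> by (simp add: mult_left_mono)
    also have "\<dots> = (\<Sum>l\<in>I. (R ^\<^sub>m k) $$ (i, l) * c)"
      by (simp add: sum_distrib_left mult.commute)
    also have "\<dots> \<le> (\<Sum>l\<in>I. (R ^\<^sub>m k) $$ (i, l) * (\<Sum>j\<in>I. R $$ (l, j)))"
      using i by (intro sum_mono mult_left_mono rows Rk_nonneg less)
    also have "\<dots> \<le> (\<Sum>l<n. (R ^\<^sub>m k) $$ (i, l) * (\<Sum>j\<in>I. R $$ (l, j)))"
      by (intro sum_mono2 mult_nonneg_nonneg sum_nonneg nonneg Rk_nonneg)
        (use I less i in auto)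
    also have "\<dots> = (\<Sum>j\<in>I. \<Sum>l<n. (R ^\<^sub>m k) $$ (i, l) * R $$ (l, j))"
      unfolding sum_distrib_left by (rule sum.swap)
    also have "\<dots> = (\<Sum>j\<in>I. (R ^\<^sub>m Suc k) $$ (i, j))"
      using i by (intro sum.cong refl entry[symmetric] less)
    finally show ?thesis .
  qed
  moreover have "0 \<le> (R ^\<^sub>m Suc k) $$ (i, j)" if "i < n" "j < n" for i j
    unfolding entry[OF that] using Suc nonneg that by (intro sum_nonneg) auto
  ultimately show ?case by blast
qed

text \<open>If every eigenvalue were smaller than \<open>c\<close>, then for some \<open>d < c\<close> the powers of
  \<open>M / d\<close> would be bounded, whereas their row sums over \<open>I\<close> grow like \<open>(c / d) ^ k\<close>.\<close>

lemma eigenvalue_ge_row_sums: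
  fixes M :: "real mat"
  assumes M: "M \<in> carrier_mat n n"
    and symm: "\<And>i j. i < n \<Longrightarrow> j < n \<Longrightarrow> M $$ (i, j) = M $$ (j, i)"
    and nonneg: "\<And>i j. i < n \<Longrightarrow> j < n \<Longrightarrow> 0 \<le> M $$ (i, j)"
    and psd: "\<And>k. eigenvalue M k \<Longrightarrow> 0 \<le> k"
    and I: "I \<subseteq> {..<n}" "I \<noteq> {}"
    and rows: "\<And>i. i \<in> I \<Longrightarrow> c \<le> (\<Sum>j\<in>I. M $$ (i, j))"
  shows "\<exists>k. eigenvalue M k \<and> c \<le> k"
proof (rule ccontr)
  assume "\<not> ?thesis"
  then have small: "k < c" if "eigenvalue M k" for k
    using that by (meson not_le)
  let ?C = "map_mat complex_of_real M"
  have C: "?C \<in> carrier_mat n n" using M by simp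
  obtain i0 where i0: "i0 \<in> I" "i0 < n" using I by auto
  then have n: "n > 0" by simp
  define r where "r = spectral_radius ?C"
  obtain z where "z \<in> spectrum ?C" and z: "r = cmod z"
    using spectral_radius_mem_max(1)[OF C n] unfolding r_def by auto
  then have "eigenvalue ?C z" by (simp add: spectrum_def)
  \<comment> \<open>Symmetry makes the eigenvalue of largest modulus real and \<open>psd\<close>
    makes it nonnegative, so \<open>r\<close> is itself an eigenvalue of \<open>M\<close> and lies
    below \<open>c\<close>.\<close>
  then obtain k where "z = complex_of_real k" "eigenvalue M k"
    using eigenvalue_of_real_symmetric[OF M symm] by blast
  then have r: "0 \<le> r" "r < c" using psd small z by auto
  \<comment> \<open>Any value strictly between \<open>r\<close> and \<open>c\<close> serves:
    dividing by it brings the spectral radius below 1 but leaves the row sums over \<open>I\<close>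
    at least \<open>c / d\<close>, which exceeds 1.\<close>
  define d where "d = (r + c) / 2"
  have d: "0 < d" "r < d" "d < c" using r by (auto simp: d_def)
  define R where "R = (1 / d) \<cdot>\<^sub>m M"
  have R: "R \<in> carrier_mat n n" using M by (simp add: R_def)
  let ?D = "map_mat complex_of_real R"
  have D: "?D \<in> carrier_mat n n" using R by simp
  have DC: "?C = complex_of_real d \<cdot>\<^sub>m ?D"
    using M d by (intro eq_matI) (auto simp: R_def)
  have "spectral_radius ?D < 1"
  proof -
    obtain w where w: "w \<in> spectrum ?D" "spectral_radius ?D = cmod w"
      using spectral_radius_mem_max(1)[OF D n] by auto
    then obtain v where v: "v \<in> carrier_vec n" "v \<noteq> 0\<^sub>v n" "?D *\<^sub>v v = w \<cdot>\<^sub>v v"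
      using R unfolding spectrum_def eigenvalue_def eigenvector_def by auto
    have "?C *\<^sub>v v = complex_of_real d \<cdot>\<^sub>v (?D *\<^sub>v v)"
      unfolding DC using D v(1) by auto
    also have "\<dots> = (complex_of_real d * w) \<cdot>\<^sub>v v"
      unfolding v(3) by (simp add: smult_smult_assoc)
    finally have "complex_of_real d * w \<in> spectrum ?C"
      using v M unfolding spectrum_def eigenvalue_def eigenvector_def by auto
    then have "cmod (complex_of_real d * w) \<le> r"
      unfolding r_def by (intro spectral_radius_mem_max(2)[OF C n]) auto
    then have "d * cmod w \<le> r" using d by (simp add: norm_mult)
    then have "d * cmod w < d * 1" using d by linarith
    then show ?thesis using d w by (simp only: mult_less_cancel_left_pos)
  qed
  \<comment> \<open>Spectral radius below 1 bounds the entries of all powers at once, independently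
    of the exponent.\<close>
  then obtain b where b: "\<And>k. norm_bound (?D ^\<^sub>m k) b"
    using spectral_radius_jnf_norm_bound_less_1_upper_triangular[OF D] by blast
  have bound: "(R ^\<^sub>m k) $$ (i, j) \<le> b" if "i < n" "j < n" for i j k
  proof -
    have "?D ^\<^sub>m k = map_mat complex_of_real (R ^\<^sub>m k)"
      by (rule of_real_hom.mat_hom_pow[OF R, symmetric])
    then have "cmod (complex_of_real ((R ^\<^sub>m k) $$ (i, j))) \<le> b"
      using b[of k] R that unfolding norm_bound_def by auto
    then show ?thesis by simp
  qed
  have "(c / d) ^ k \<le> real (card I) * b" for k
  proof -
    have "c / d \<le> (\<Sum>j\<in>I. R $$ (i, j))" if i: "i \<in> I" for i
    proof -
      have "R $$ (i, j) = M $$ (i, j) / d" if "j \<in> I" for j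
      proof -
        have "i < n" "j < n" using i that I by auto
        then show ?thesis using M by (simp add: R_def)
      qed
      then have "(\<Sum>j\<in>I. R $$ (i, j)) = (\<Sum>j\<in>I. M $$ (i, j)) / d"
        unfolding sum_divide_distrib by (intro sum.cong) auto
      then show ?thesis using rows[OF i] d by (simp add: divide_right_mono)
    qed
    moreover have "0 \<le> R $$ (i, j)" if "i < n" "j < n" for i j
      using nonneg that M d by (simp add: R_def)
    ultimately have "(c / d) ^ k \<le> (\<Sum>j\<in>I. (R ^\<^sub>m k) $$ (i0, j))"
      using pow_mat_row_sums_ge[OF R _ I(1), of "c / d" k] d i0 by auto
    also have "\<dots> \<le> (\<Sum>j\<in>I. b)"
      using i0 I by (intro sum_mono bound) auto
    finally show ?thesis by simp
  qed
  moreover have "1 < c / d" using d by simp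
  then obtain k where "real (card I) * b < (c / d) ^ k"
    using real_arch_pow by blast
  ultimately show False by (meson not_le)
qed

section \<open>The signless Laplacian\<close>

lemma signless_Laplacian_carrier:
  "signless_Laplacian G \<in> carrier_mat (card (pverts G)) (card (pverts G))"
  by (simp add: signless_Laplacian_def degree_matrix_def adjacency_matrix_def)

lemma signless_Laplacian_index:
  assumes "i < card (pverts G)" "j < card (pverts G)"
  shows "signless_Laplacian G $$ (i, j) =
    (if i = j then real (vertex_degree G (vertex_list G ! i)) else 0) +
    of_bool ((vertex_list G ! i, vertex_list G ! j) \<in> parcs G)"
  using assms by (simp add: signless_Laplacian_def degree_matrix_def adjacency_matrix_def)

lemma bij_betw_vertex_list:
  assumes "finite (pverts G)"
  shows "bij_betw ((!) (vertex_list G)) {..<card (pverts G)} (pverts G)"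
  using vertex_list[OF assms] by (intro bij_betw_nth) auto

text \<open>Turns the diagonal of the signless Laplacian into row sums of the adjacency matrix, so
  that row \<open>i\<close> applied to \<open>x\<close> becomes a sum of terms
  \<open>a i j * (x $ i + x $ j)\<close>.\<close>

lemma vertex_degree_eq_sum:
  assumes "pair_graph G"
  shows "real (vertex_degree G v) =
    (\<Sum>j<card (pverts G). of_bool ((v, vertex_list G ! j) \<in> parcs G))"
proof -
  interpret pair_graph G by fact
  have "{u. (v, u) \<in> parcs G} = pverts G \<inter> {u. (v, u) \<in> parcs G}"
    by (auto dest: in_arcsD2)
  then have "real (vertex_degree G v) = (\<Sum>u\<in>pverts G. of_bool ((v, u) \<in> parcs G))"
    using pair_finite_verts by (simp add: vertex_degree_eq_card_neighbours[OF assms])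
  then show ?thesis
    using sum.reindex_bij_betw[OF bij_betw_vertex_list[OF pair_finite_verts],
        of "\<lambda>u. of_bool ((v, u) \<in> parcs G) :: real"] by simp
qed

text \<open>Twice the quadratic form at \<open>x\<close> is the sum of
  \<open>a i j * (x $ i + x $ j)\<^sup>2\<close> over all \<open>i\<close> and \<open>j\<close>,
  hence nonnegative. At an eigenvector the form is also \<open>k\<close> times the squared
  norm.\<close>

lemma signless_Laplacian_eigenvalue_nonneg:
  assumes G: "pair_graph G" and ev: "eigenvalue (signless_Laplacian G) k"
  shows "0 \<le> k"
proof -
  interpret pair_graph G by fact
  let ?n = "card (pverts G)"
  let ?M = "signless_Laplacian G"
  define a :: "nat \<Rightarrow> nat \<Rightarrow> real"
    where "a i j = of_bool ((vertex_list G ! i, vertex_list G ! j) \<in> parcs G)" for i j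
  have a_sym: "a i j = a j i" for i j
    using pair_sym_arcs by (auto simp: a_def symmetric_def sym_def)
  note M = signless_Laplacian_carrier[of G]
  obtain x where x: "x \<in> carrier_vec ?n" "x \<noteq> 0\<^sub>v ?n" "?M *\<^sub>v x = k \<cdot>\<^sub>v x"
    using ev M unfolding eigenvalue_def eigenvector_def by auto
  have row: "(\<Sum>j<?n. a i j * (x $ i + x $ j)) = k * x $ i" if i: "i < ?n" for i
  proof -
    have "k * x $ i = (?M *\<^sub>v x) $ i" using x i by simp
    also have "\<dots> = (\<Sum>j<?n. ?M $$ (i, j) * x $ j)"
      using M x(1) i by (auto simp: scalar_prod_def lessThan_atLeast0 intro!: sum.cong)
    also have "\<dots> = (\<Sum>j<?n. (if i = j then (\<Sum>l<?n. a i l) * x $ i else 0) + a i j * x $ j)"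
      using i by (intro sum.cong)
        (auto simp: signless_Laplacian_index vertex_degree_eq_sum[OF G] a_def algebra_simps)
    also have "\<dots> = (\<Sum>l<?n. a i l) * x $ i + (\<Sum>j<?n. a i j * x $ j)"
      using i by (simp add: sum.distrib)
    also have "\<dots> = (\<Sum>j<?n. a i j * (x $ i + x $ j))"
      by (simp add: sum_distrib_right sum.distrib distrib_left)
    finally show ?thesis by simp
  qed
  let ?F = "\<Sum>i<?n. \<Sum>j<?n. a i j * (x $ i + x $ j) * x $ i"
  have F: "?F = k * (\<Sum>i<?n. (x $ i)\<^sup>2)"
    unfolding sum_distrib_right[symmetric] sum_distrib_left
    by (intro sum.cong) (auto simp: row power2_eq_square)
  \<comment> \<open>Exchanging \<open>i\<close> and \<open>j\<close> replaces the last factor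
    \<open>x $ i\<close> by \<open>x $ j\<close>; adding both versions completes the square.\<close>
  have "?F = (\<Sum>i<?n. \<Sum>j<?n. a j i * (x $ j + x $ i) * x $ j)"
    by (rule sum.swap)
  also have "\<dots> = (\<Sum>i<?n. \<Sum>j<?n. a i j * (x $ i + x $ j) * x $ j)"
    by (intro sum.cong) (auto simp: a_sym add.commute)
  finally have swapped: "?F = (\<Sum>i<?n. \<Sum>j<?n. a i j * (x $ i + x $ j) * x $ j)" .
  have "2 * ?F = ?F + (\<Sum>i<?n. \<Sum>j<?n. a i j * (x $ i + x $ j) * x $ j)"
    unfolding swapped[symmetric] by (rule mult_2)
  also have "\<dots> = (\<Sum>i<?n. \<Sum>j<?n. a i j * (x $ i + x $ j)\<^sup>2)"
    unfolding sum.distrib[symmetric]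
    by (intro sum.cong refl) (simp add: power2_eq_square algebra_simps)
  also have "\<dots> \<ge> 0"
    by (intro sum_nonneg) (auto simp: a_def)
  finally have "0 \<le> k * (\<Sum>i<?n. (x $ i)\<^sup>2)" unfolding F by simp
  moreover obtain i where "i < ?n" "x $ i \<noteq> 0"
    using x(1,2) by (metis eq_vecI carrier_vecD index_zero_vec)
  then have "(\<Sum>i<?n. (x $ i)\<^sup>2) > 0"
    by (intro sum_pos2[of _ i]) auto
  ultimately show ?thesis by (simp add: zero_le_mult_iff)
qed

text \<open>In the row of a vertex of \<open>T\<close>, the degree on the diagonal is at least
  \<open>card T - 1\<close>, and the adjacency entries towards \<open>T\<close> sum to exactly
  \<open>card T - 1\<close>. The row-sum bound on the index set of \<open>T\<close> then yields a
  large eigenvalue.\<close>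

lemma q1_ge_clique:
  assumes G: "pair_graph G"
    and T: "T \<subseteq> pverts G" "T \<noteq> {}"
    and clique: "\<And>u v. u \<in> T \<Longrightarrow> v \<in> T \<Longrightarrow> u \<noteq> v \<Longrightarrow> (u, v) \<in> parcs G"
  shows "2 * (real (card T) - 1) \<le> q1 G"
proof -
  interpret pair_graph G by fact
  let ?n = "card (pverts G)"
  let ?vs = "vertex_list G"
  let ?M = "signless_Laplacian G"
  note bij = bij_betw_vertex_list[OF pair_finite_verts]
  have finT: "finite T" using T pair_finite_verts finite_subset by blast
  \<comment> \<open>Ensures that the natural-number difference \<open>card T - 1\<close> agrees with
    the real one.\<close>
  have cardT: "card T \<ge> 1" using T finT by (simp add: Suc_leI card_gt_0_iff)
  define I where "I = {i. i < ?n \<and> ?vs ! i \<in> T}"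
  have I: "I \<subseteq> {..<?n}" by (auto simp: I_def)
  have finI: "finite I" using I finite_subset by blast
  have img: "(!) ?vs ` I = T"
  proof
    show "T \<subseteq> (!) ?vs ` I"
    proof
      fix t assume t: "t \<in> T"
      then have "t \<in> (!) ?vs ` {..<?n}" using bij T(1) by (auto simp: bij_betw_def)
      then show "t \<in> (!) ?vs ` I" using t by (auto simp: I_def)
    qed
  qed (auto simp: I_def)
  have bijI: "bij_betw ((!) ?vs) I T"
    using bij_betw_subset[OF bij I img] .
  have "I \<noteq> {}" using img T by auto
  have rows: "2 * (real (card T) - 1) \<le> (\<Sum>j\<in>I. ?M $$ (i, j))" if i: "i \<in> I" for i
  proof -
    let ?v = "?vs ! i"
    have v: "?v \<in> T" using i by (simp add: I_def)
    have "card (T - {?v}) \<le> card {u. (?v, u) \<in> parcs G}"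
    proof (rule card_mono)
      show "finite {u. (?v, u) \<in> parcs G}"
        by (rule finite_subset[OF _ pair_finite_verts]) (auto dest: in_arcsD2)
    qed (use clique v in auto)
    then have deg: "real (card T) - 1 \<le> real (vertex_degree G ?v)"
      using v cardT by (simp add: vertex_degree_eq_card_neighbours[OF G])
    have "T \<inter> {u. (?v, u) \<in> parcs G} = T - {?v}"
      using clique v by (auto dest: no_loops')
    then have "(\<Sum>u\<in>T. of_bool ((?v, u) \<in> parcs G) :: real) = real (card T) - 1"
      using finT v cardT by (simp add: of_nat_diff)
    then have adj: "(\<Sum>j\<in>I. of_bool ((?v, ?vs ! j) \<in> parcs G) :: real) = real (card T) - 1"
      using sum.reindex_bij_betw[OF bijI, of "\<lambda>u. of_bool ((?v, u) \<in> parcs G) :: real"] by simp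
    have "(\<Sum>j\<in>I. ?M $$ (i, j)) = (\<Sum>j\<in>I. (if i = j then real (vertex_degree G ?v) else 0) +
        of_bool ((?v, ?vs ! j) \<in> parcs G))"
      using i by (intro sum.cong refl signless_Laplacian_index) (auto simp: I_def)
    also have "\<dots> = real (vertex_degree G ?v) + (real (card T) - 1)"
      using i finI adj by (simp add: sum.distrib)
    finally show ?thesis using deg by simp
  qed
  note M = signless_Laplacian_carrier[of G]
  have "\<exists>k. eigenvalue ?M k \<and> 2 * (real (card T) - 1) \<le> k"
  proof (rule eigenvalue_ge_row_sums[OF M _ _ _ I \<open>I \<noteq> {}\<close> rows])
    show "?M $$ (i, j) = ?M $$ (j, i)" if "i < ?n" "j < ?n" for i j
      using that pair_sym_arcs
      by (auto simp: signless_Laplacian_index symmetric_def sym_def)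
  qed (auto simp: signless_Laplacian_index intro: signless_Laplacian_eigenvalue_nonneg[OF G])
  then obtain k where k: "eigenvalue ?M k" "2 * (real (card T) - 1) \<le> k" by blast
  \<comment> \<open>Finiteness of the set of eigenvalues lets \<open>Max\<close> in
    \<open>q1\<close> act as an upper bound.\<close>
  have "finite {k. eigenvalue ?M k}"
    using card_finite_spectrum(1)[OF M] by (simp add: spectrum_def)
  then have "k \<le> q1 G" unfolding q1_def using k by (intro Max_ge) auto
  with k show ?thesis by simp
qed

theorem theorem4p2:
  fixes G :: "'a pair_pre_digraph" and n \<delta> :: nat
  assumes "pair_graph G"
    and "card (pverts G) = n"
    and "Digraph_Component.connected (with_proj G)"
    and "min_degree G = \<delta>"
    and "q1 (graph_complement G) < 2 * real \<delta>"
  shows "\<exists>f. fractional_perfect_matching G f"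
proof (rule ccontr)
  assume "\<nexists>f. fractional_perfect_matching G f"
  then obtain T where T: "T \<subseteq> pverts G"
    and indep: "\<And>u v. u \<in> T \<Longrightarrow> v \<in> T \<Longrightarrow> (u, v) \<notin> parcs G" and card: "\<delta> < card T"
    using independent_set_of_no_fractional_perfect_matching[OF assms(1)] assms(4) by metis
  \<comment> \<open>\<open>T\<close> is a clique of the complement. Cardinalities being integers,
    \<open>\<delta> < card T\<close> means that \<open>card T - 1\<close> is at least
    \<open>\<delta>\<close>, which contradicts the assumed bound on \<open>q1\<close>.\<close>
  have "2 * (real (card T) - 1) \<le> q1 (graph_complement G)"
    by (rule q1_ge_clique[OF pair_graph_graph_complement[OF assms(1)]])
      (use T indep card in \<open>auto simp: graph_complement_def\<close>)
  also note assms(5)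
  finally show False using card by simp
qed

end
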